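(* Let $n$ be a positive integer and consider the functions $\|\cdot\|_2^p:\mathbb{R}^n\to\mathbb{R}$ and $\|\cdot\|_p^p:\mathbb{R}^n\to\mathbb{R}$. Then: (i) $\alpha(\|\cdot\|_2^p)=\alpha(\|\cdot\|_p^p)>(2p)^{-1}$ holds for all $p\in(2,\infty)$. (ii) $\alpha(\|\cdot\|_2^p)=\alpha(\|\cdot\|_p^p)\sim(2p)^{-1}$ as $p\to\infty$.
   Context: For $r>1$, $\|x\|_r=(\sum_{j=1}^n|x_j|^r)^{1/r}$. For a differentiable strictly convex function $h:\mathbb{R}^n\to\mathbb{R}$ (such as $\|\cdot\|_2^p$ and $\|\cdot\|_p^p$ for $p>1$), the Bregman distance is $D_h(x,y):=h(x)-h(y)-\langle\nabla h(y),x-y\rangle$ and the symmetry coefficient is $$\alpha(h):=\inf\left\{\frac{D_h(x,y)}{D_h(y,x)}\;\middle|\;x,y\in\mathbb{R}^n,\ x\neq y\right\}.$$ The notation $a(p)\sim b(p)$ as $p\to\infty$ means $\lim_{p\to\infty}a(p)/b(p)=1$. *)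

theory Defs
  imports "HOL-Analysis.Analysis" "HOL-Library.Landau_Symbols"
begin

definition lr_norm :: "real \<Rightarrow> real ^ 'n \<Rightarrow> real" where
  "lr_norm r x = (\<Sum>j\<in>UNIV. \<bar>x $ j\<bar> powr r) powr (1 / r)"

lemma lr_norm_2: "lr_norm 2 (x :: real ^ 'n) = norm x"
  by (simp add: lr_norm_def norm_vec_def L2_set_def powr_half_sqrt sum_nonneg)

(* Meaningful only where h is differentiable; there the gradient is unique. *)
definition gradient :: "('a::real_inner \<Rightarrow> real) \<Rightarrow> 'a \<Rightarrow> 'a" where
  "gradient h y = (THE g. GDERIV h y :> g)"

lemma gradient_eqI: "GDERIV h y :> g \<Longrightarrow> gradient h y = g"
  unfolding gradient_def gderiv_def
proof (rule the_equality)
  fix g' assume *: "(h has_derivative (\<lambda>z. inner z g)) (at y)"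
    "(h has_derivative (\<lambda>z. inner z g')) (at y)"
  have "(\<lambda>z. inner z g') = (\<lambda>z. inner z g)"
    using has_derivative_unique[OF *(2,1)] .
  then have "inner z (g' - g) = 0" for z
    by (metis inner_diff_right diff_self)
  then show "g' = g"
    by (metis inner_eq_zero_iff right_minus_eq)
qed

definition bregman :: "('a::real_inner \<Rightarrow> real) \<Rightarrow> 'a \<Rightarrow> 'a \<Rightarrow> real" where
  "bregman h x y = h x - h y - inner (gradient h y) (x - y)"

(* For h differentiable and strictly convex, bregman h is positive off the diagonal,
   so the set below is nonempty (in positive dimension) and bounded below by 0,
   and the real-valued Inf is the true infimum. *)
definition symmetry_coefficient :: "('a::real_inner \<Rightarrow> real) \<Rightarrow> real" where
  "symmetry_coefficient h = Inf {bregman h x y / bregman h y x | x y. x \<noteq> y}"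

end

theory Submission
  imports Defs "HOL-Real_Asymp.Real_Asymp"
begin

text \<open>
  Both coefficients equal the coefficient \<open>\<alpha>\<close> of the one-dimensional function
  \<open>\<bar>t\<bar> powr p\<close>, and \<open>\<alpha>\<close> is estimated by elementary calculus.

  The coefficient of \<open>h\<close> is the largest \<open>l\<close> with
  \<open>l * D y x \<le> D x y\<close> for all \<open>x\<close>, \<open>y\<close>, where \<open>D\<close> is the Bregman distance of \<open>h\<close>
  (\<open>le_symmetry_coefficient_iff\<close>). So two functions have the same coefficient as soon as these
  inequalities can be carried from each to the other. From dimension \<open>n\<close> to dimension one, restrict
  to a line. Conversely, for \<open>norm x powr p\<close> the inequality is affine in \<open>inner x y\<close>
  when \<open>norm x\<close> and \<open>norm y\<close> are fixed, so it is enough to have it at the endpoints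
  \<open>\<plusminus> norm x * norm y\<close>, which are the one-dimensional instances
  (\<open>symmetry_coefficient_norm_powr\<close>). For \<open>\<Sum>j. \<bar>x $ j\<bar> powr p\<close> the Bregman distance is a
  sum over coordinates, and the one-dimensional inequalities can be added up
  (\<open>symmetry_coefficient_lr_norm_powr\<close>).

  In dimension one, homogeneity reduces the ratio to \<open>D x 1 / D 1 x\<close>. For \<open>x \<ge> 0\<close>, \<open>x \<noteq> 1\<close>
  it is at least \<open>1 / (p - 1)\<close> by Bernoulli's inequality; for \<open>x = - u < 0\<close> it is
  \<open>(u powr p + p * u + p - 1) / ((p - 1) * u powr p + p * u powr (p - 1) + 1)\<close>,
  which is at least \<open>1 / (2 * p - 1)\<close>. Hence \<open>\<alpha> \<ge> 1 / (2 * p - 1) > 1 / (2 * p)\<close>.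
  This bound is asymptotically sharp: if \<open>u\<close> tends to \<open>1\<close> from above so slowly that
  \<open>u powr p / p\<close> still tends to infinity, the terms with \<open>u powr p\<close> and \<open>u powr (p - 1)\<close>
  dominate, and the ratio behaves like \<open>1 / (p - 1 + p / u)\<close>, thus like \<open>1 / (2 * p)\<close>.
\<close>

section \<open>The symmetry coefficient as a best constant\<close>

text \<open>
  Positivity off the diagonal clears the denominators and gives the set of ratios the lower
  bound \<open>0\<close>; \<open>perfect_space\<close> provides two distinct points, so that this set is nonempty.
\<close>
lemma le_symmetry_coefficient_iff:
  fixes h :: "'a::{real_inner, perfect_space} \<Rightarrow> real"
  assumes pos: "\<And>x y. x \<noteq> y \<Longrightarrow> bregman h x y > 0"
  shows "l \<le> symmetry_coefficient h \<longleftrightarrow> (\<forall>x y. l * bregman h y x \<le> bregman h x y)"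
proof -
  let ?S = "{bregman h x y / bregman h y x | x y. x \<noteq> y}"
  obtain a :: 'a where "a \<noteq> 0"
    using UNIV_not_singleton[of "0::'a"] by auto
  then have "?S \<noteq> {}"
    by blast
  moreover have "bdd_below ?S"
  proof (rule bdd_belowI[of _ 0])
    show "0 \<le> r" if "r \<in> ?S" for r
      using that pos by (smt (verit) mem_Collect_eq zero_less_divide_iff)
  qed
  ultimately have "l \<le> symmetry_coefficient h \<longleftrightarrow> (\<forall>r\<in>?S. l \<le> r)"
    unfolding symmetry_coefficient_def by (rule le_cInf_iff)
  also have "\<dots> \<longleftrightarrow> (\<forall>x y. x \<noteq> y \<longrightarrow> l \<le> bregman h x y / bregman h y x)"
    by blast
  also have "\<dots> \<longleftrightarrow> (\<forall>x y. x \<noteq> y \<longrightarrow> l * bregman h y x \<le> bregman h x y)"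
    using pos by (simp add: pos_le_divide_eq)
  also have "\<dots> \<longleftrightarrow> (\<forall>x y. l * bregman h y x \<le> bregman h x y)"
    by (metis bregman_def cancel_comm_monoid_add_class.diff_cancel inner_zero_right mult_zero_right order_refl)
  finally show ?thesis .
qed

text \<open>
  The form in which coefficients are compared below: \<open>k\<close> is the one-dimensional
  function, the embedding \<open>e\<close> shows that the coefficient of \<open>h\<close> is not larger than that of \<open>k\<close>,
  and the last premise that it is not smaller.
\<close>
lemma symmetry_coefficient_eqI:
  fixes h :: "'a::{real_inner, perfect_space} \<Rightarrow> real"
    and k :: "'b::{real_inner, perfect_space} \<Rightarrow> real"
  assumes "\<And>x y. x \<noteq> y \<Longrightarrow> bregman h x y > 0"
    and "\<And>x y. x \<noteq> y \<Longrightarrow> bregman k x y > 0"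
    and emb: "\<And>s t. bregman h (e s) (e t) = bregman k s t"
    and trans: "\<And>l x y. (\<And>s t. l * bregman k t s \<le> bregman k s t) \<Longrightarrow> l * bregman h y x \<le> bregman h x y"
  shows "symmetry_coefficient h = symmetry_coefficient k"
proof -
  have "l \<le> symmetry_coefficient h \<longleftrightarrow> l \<le> symmetry_coefficient k" for l
    unfolding le_symmetry_coefficient_iff[of h, OF assms(1), simplified]
      le_symmetry_coefficient_iff[of k, OF assms(2), simplified]
    using trans by (metis emb)
  then show ?thesis
    by (meson dual_order.antisym order_refl)
qed

section \<open>Powers of an inner product norm\<close>

text \<open>
  Away from the origin this is the chain rule. At the origin the norm is not differentiable,
  but the difference quotient of its power is \<open>norm z powr (p - 1)\<close>, which vanishes in the limit;
  the formula gives the right value \<open>0\<close> there because of the factor \<open>y\<close>.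
\<close>
lemma gderiv_norm_powr:
  fixes y :: "'a::real_inner"
  assumes "p > 1"
  shows "GDERIV (\<lambda>x. norm x powr p) y :> (p * norm y powr (p - 2)) *\<^sub>R y"
proof (cases "y = 0")
  case False
  have "((\<lambda>t. t powr p) has_real_derivative p * norm y powr (p - 1)) (at (norm y))"
    using False by (intro has_real_derivative_powr) simp
  from GDERIV_DERIV_compose[OF GDERIV_norm[OF False] this] show ?thesis
    using False by (simp add: sgn_div_norm powr_diff power2_eq_square field_simps)
next
  case True
  have "((\<lambda>z::'a. norm z powr (p - 1)) \<longlongrightarrow> 0) (at 0)"
    using assms by (intro tendsto_zero_powrI tendsto_norm_zero tendsto_ident_at tendsto_const) auto
  moreover have "norm z powr p / norm z = norm z powr (p - 1)" for z :: 'a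
    by (cases "z = 0") (simp_all add: powr_diff)
  ultimately show ?thesis
    using True by (simp add: gderiv_def has_derivative_at)
qed

lemma bregman_norm_powr:
  fixes x y :: "'a::real_inner"
  assumes "p > 1"
  shows "bregman (\<lambda>x. norm x powr p) x y
    = norm x powr p + (p - 1) * norm y powr p - p * norm y powr (p - 2) * inner x y"
proof -
  have "norm y powr (p - 2) * inner y y = norm y powr p"
    by (cases "y = 0") (simp_all add: dot_square_norm powr_diff)
  then show ?thesis
    unfolding bregman_def gradient_eqI[OF gderiv_norm_powr[OF assms]]
    by (simp add: inner_diff_right algebra_simps inner_commute)
qed

corollary bregman_abs_powr:
  fixes s t :: real
  assumes "p > 1"
  shows "bregman (\<lambda>t. \<bar>t\<bar> powr p) s t
    = \<bar>s\<bar> powr p + (p - 1) * \<bar>t\<bar> powr p - p * \<bar>t\<bar> powr (p - 2) * (s * t)"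
  using bregman_norm_powr[OF assms, of s t] by (simp add: mult.commute)

text \<open>
  Strict Bernoulli inequality for real exponents, from the mean value theorem. Strictness is what
  makes the Bregman distances positive off the diagonal.
\<close>
lemma powr_gt_tangent:
  fixes q x :: real
  assumes "q > 1" "x \<ge> 0" "x \<noteq> 1"
  shows "x powr q > 1 + q * (x - 1)"
proof (cases "x = 0")
  case False
  with assms have "x > 0" by simp
  have D: "((\<lambda>x. x powr q) has_real_derivative q * t powr (q - 1)) (at t)" if "t > 0" for t
    using that by (rule has_real_derivative_powr)
  consider "x < 1" | "x > 1"
    using assms by linarith
  then show ?thesis
  proof cases
    case 1
    obtain z where z: "x < z" "z < 1" "1 powr q - x powr q = (1 - x) * (q * z powr (q - 1))"
      using MVT2[OF 1, of "\<lambda>x. x powr q" "\<lambda>t. q * t powr (q - 1)"] D \<open>x > 0\<close> by auto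
    have "z powr (q - 1) < 1"
      using z \<open>x > 0\<close> assms powr_less_mono2[of "q - 1" z 1] by simp
    then have "(1 - x) * (q * z powr (q - 1)) < (1 - x) * (q * 1)"
      using 1 assms by (intro mult_strict_left_mono) auto
    then show ?thesis
      using z by (simp add: algebra_simps)
  next
    case 2
    obtain z where z: "1 < z" "z < x" "x powr q - 1 powr q = (x - 1) * (q * z powr (q - 1))"
      using MVT2[OF 2, of "\<lambda>x. x powr q" "\<lambda>t. q * t powr (q - 1)"] D by auto
    have "z powr (q - 1) > 1"
      using z assms by simp
    then have "(x - 1) * (q * z powr (q - 1)) > (x - 1) * (q * 1)"
      using 2 assms by (intro mult_strict_left_mono) auto
    then show ?thesis
      using z by (simp add: algebra_simps)
  qed
qed (use assms in simp)

text \<open>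
  For \<open>y \<noteq> 0\<close> the distance is the sum of a Bernoulli term \<open>E\<close>, the distance between
  the norms, and a Cauchy--Schwarz term \<open>G\<close>. Both are nonnegative; \<open>E\<close> is positive if
  the norms differ, and \<open>G\<close> is positive if they agree, since equality in Cauchy--Schwarz
  would then force \<open>x = y\<close>.
\<close>
lemma bregman_norm_powr_pos:
  fixes x y :: "'a::real_inner"
  assumes p: "p > 1" and "x \<noteq> y"
  shows "bregman (\<lambda>x. norm x powr p) x y > 0"
proof (cases "y = 0")
  case True
  then show ?thesis
    using assms by (simp add: bregman_norm_powr)
next
  case False
  define u where "u = norm x / norm y"
  have x: "norm x = u * norm y" and "u \<ge> 0"
    using False by (simp_all add: u_def)
  have pw: "norm y powr (p - 2) * norm y * norm y = norm y powr p"
    using False by (simp add: powr_diff power2_eq_square)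
  define E where "E = norm y powr p * (u powr p - (1 + p * (u - 1)))"
  define G where "G = p * norm y powr (p - 2) * (norm x * norm y - inner x y)"
  have "norm x powr p = u powr p * norm y powr p"
    unfolding x using \<open>u \<ge> 0\<close> by (simp add: powr_mult)
  moreover have "norm y powr (p - 2) * (norm x * norm y) = u * norm y powr p"
    unfolding x pw[symmetric] by simp
  ultimately have eq: "bregman (\<lambda>x. norm x powr p) x y = E + G"
    unfolding bregman_norm_powr[OF p] E_def G_def by (simp add: algebra_simps)
  have "G \<ge> 0"
    using p norm_cauchy_schwarz[of x y] by (simp add: G_def)
  show ?thesis
  proof (cases "u = 1")
    case True
    have "inner x y \<noteq> norm x * norm y"
    proof
      assume "inner x y = norm x * norm y"
      then have "norm x *\<^sub>R y = norm y *\<^sub>R x"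
        by (simp add: norm_cauchy_schwarz_eq)
      then show False
        using True x False \<open>x \<noteq> y\<close> by simp
    qed
    then have "G > 0"
      using p False norm_cauchy_schwarz[of x y] by (simp add: G_def)
    then show ?thesis
      using True by (simp add: eq E_def)
  next
    case u: False
    then have "E > 0"
      using False powr_gt_tangent[OF p \<open>u \<ge> 0\<close> u] by (simp add: E_def)
    then show ?thesis
      using \<open>G \<ge> 0\<close> by (simp add: eq)
  qed
qed

corollary bregman_abs_powr_pos:
  fixes s t :: real
  assumes "p > 1" and "s \<noteq> t"
  shows "bregman (\<lambda>t. \<bar>t\<bar> powr p) s t > 0"
  using bregman_norm_powr_pos[OF assms] by simp

section \<open>Reduction to one dimension\<close>

text \<open>TODO\<close>
text \<open>
  For fixed norms of \<open>x\<close> and \<open>y\<close>, the inequality \<open>l * D y x \<le> D x y\<close> reads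
  \<open>B * inner x y \<le> A\<close>. It holds on the whole Cauchy--Schwarz interval as soon as it holds at
  its endpoints, where it is the one-dimensional inequality for \<open>norm x\<close> and
  \<open>\<plusminus> norm y\<close>.
\<close>
lemma symmetry_coefficient_norm_powr:
  assumes p: "p > 1"
  shows "symmetry_coefficient (\<lambda>x::'a::{real_inner, perfect_space}. norm x powr p)
    = symmetry_coefficient (\<lambda>t::real. \<bar>t\<bar> powr p)"
proof -
  obtain a :: 'a where a: "a \<noteq> 0"
    using UNIV_not_singleton[of "0::'a"] by auto
  define e where "e = a /\<^sub>R norm a"
  have e: "norm e = 1" "inner e e = 1"
    using a by (simp_all add: e_def dot_square_norm power2_eq_square)
  show ?thesis
  proof (rule symmetry_coefficient_eqI[where e = "\<lambda>t. t *\<^sub>R e"])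
    show "bregman (\<lambda>x. norm x powr p) (s *\<^sub>R e) (t *\<^sub>R e) = bregman (\<lambda>t. \<bar>t\<bar> powr p) s t" for s t
      by (simp add: bregman_norm_powr[OF p] bregman_abs_powr[OF p] e)
  next
    fix l :: real and x y :: 'a
    assume l: "l * bregman (\<lambda>t::real. \<bar>t\<bar> powr p) t s \<le> bregman (\<lambda>t. \<bar>t\<bar> powr p) s t" for s t
    define A where "A = norm x powr p + (p - 1) * norm y powr p - l * (norm y powr p + (p - 1) * norm x powr p)"
    define B where "B = p * norm y powr (p - 2) - l * p * norm x powr (p - 2)"
    have "B * (norm x * norm y) \<le> A" "B * - (norm x * norm y) \<le> A"
      using l[where s = "norm x" and t = "norm y"] l[where s = "norm x" and t = "- norm y"]
      by (simp_all add: bregman_abs_powr[OF p] A_def B_def algebra_simps)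
    then have "\<bar>B\<bar> * (norm x * norm y) \<le> A"
      by (cases "B \<ge> 0") auto
    moreover have "B * inner x y \<le> \<bar>B\<bar> * (norm x * norm y)"
      using mult_left_mono[OF Cauchy_Schwarz_ineq2[of x y], of "\<bar>B\<bar>"] by (simp add: abs_mult[symmetric])
    ultimately have "B * inner x y \<le> A"
      by linarith
    then show "l * bregman (\<lambda>x. norm x powr p) y x \<le> bregman (\<lambda>x. norm x powr p) x y"
      by (simp add: bregman_norm_powr[OF p] A_def B_def algebra_simps inner_commute)
  qed (use p in \<open>auto intro: bregman_norm_powr_pos bregman_abs_powr_pos\<close>)
qed

lemma bregman_separable:
  fixes g :: "real \<Rightarrow> real" and x y :: "real ^ 'n"
  assumes "\<And>t. GDERIV g t :> g' t"
  shows "bregman (\<lambda>x. \<Sum>j\<in>UNIV. g (x $ j)) x y = (\<Sum>j\<in>UNIV. bregman g (x $ j) (y $ j))"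
proof -
  have "GDERIV (\<lambda>x. \<Sum>j\<in>UNIV. g (x $ j)) y :> (\<chi> j. g' (y $ j))"
  proof -
    have "((\<lambda>x. g (x $ j)) has_derivative (\<lambda>z. inner (z $ j) (g' (y $ j)))) (at y)" for j
      using has_derivative_compose[OF bounded_linear_imp_has_derivative[OF bounded_linear_vec_nth]
          assms[unfolded gderiv_def]] .
    then show ?thesis
      unfolding gderiv_def inner_vec_def by (auto intro!: has_derivative_sum)
  qed
  from gradient_eqI[OF this] gradient_eqI[OF assms] show ?thesis
    by (simp add: bregman_def inner_vec_def sum_subtractf)
qed

lemma lr_norm_powr_self: "p > 0 \<Longrightarrow> lr_norm p x powr p = (\<Sum>j\<in>UNIV. \<bar>x $ j\<bar> powr p)"
  by (simp add: lr_norm_def powr_powr sum_nonneg)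

text \<open>
  The Bregman distance is additive over coordinates, so a one-dimensional inequality sums up to
  the one on the whole space, and vectors supported on a single coordinate give it back.
\<close>
lemma symmetry_coefficient_lr_norm_powr:
  assumes p: "p > 1"
  shows "symmetry_coefficient (\<lambda>x :: real ^ 'n. lr_norm p x powr p)
    = symmetry_coefficient (\<lambda>t::real. \<bar>t\<bar> powr p)"
proof -
  let ?g = "\<lambda>t::real. \<bar>t\<bar> powr p"
  have breg: "bregman (\<lambda>x :: real ^ 'n. lr_norm p x powr p) x y
      = (\<Sum>j\<in>UNIV. bregman ?g (x $ j) (y $ j))" for x y
    using bregman_separable[OF gderiv_norm_powr[OF p]] p by (simp add: lr_norm_powr_self)
  have pos: "bregman ?g s t > 0" if "s \<noteq> t" for s t
    using p that by (rule bregman_abs_powr_pos)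
  have self: "bregman ?g t t = 0" for t
    by (simp add: bregman_def)
  then have nonneg: "bregman ?g s t \<ge> 0" for s t
    using pos[of s t] by (cases "s = t") auto
  define k :: 'n where "k = undefined"
  show ?thesis
  proof (rule symmetry_coefficient_eqI[where e = "axis k"])
    fix x y :: "real ^ 'n"
    assume "x \<noteq> y"
    then obtain j where "x $ j \<noteq> y $ j"
      by (auto simp: vec_eq_iff)
    then show "bregman (\<lambda>x :: real ^ 'n. lr_norm p x powr p) x y > 0"
      unfolding breg using nonneg pos by (intro sum_pos2[of _ j]) auto
  next
    fix s t
    have "(\<Sum>j\<in>UNIV. bregman ?g (axis k s $ j) (axis k t $ j))
        = (\<Sum>j\<in>UNIV. if j = k then bregman ?g s t else 0)"
      by (intro sum.cong) (auto simp: axis_def self)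
    then show "bregman (\<lambda>x :: real ^ 'n. lr_norm p x powr p) (axis k s) (axis k t) = bregman ?g s t"
      by (simp add: breg)
  qed (auto simp: breg pos sum_distrib_left intro: sum_mono)
qed

section \<open>Bounds on the symmetry coefficient of a power of the absolute value\<close>

text \<open>
  After scaling \<open>t\<close> to \<open>1\<close>, arguments of equal sign satisfy the inequality even with the smaller
  factor \<open>p - 1\<close>: the difference of the two sides is \<open>p\<close> times the Bernoulli defect for the exponent
  \<open>p - 1\<close>. The factor \<open>2 * p - 1\<close> is dictated by arguments of opposite sign: it makes the
  coefficient of the power \<open>u powr (p - 1)\<close> in the difference equal to \<open>p * (u - 1)\<close>, which is
  negative only for \<open>u < 1\<close>, where the power is bounded by \<open>1\<close>.
\<close>
lemma symmetry_coefficient_abs_powr_ge: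
  assumes p: "p > 2"
  shows "symmetry_coefficient (\<lambda>t::real. \<bar>t\<bar> powr p) \<ge> 1 / (2 * p - 1)"
proof -
  let ?D = "bregman (\<lambda>t::real. \<bar>t\<bar> powr p)"
  have D: "?D s t = \<bar>s\<bar> powr p + (p - 1) * \<bar>t\<bar> powr p - p * \<bar>t\<bar> powr (p - 2) * (s * t)" for s t
    using p by (simp add: bregman_abs_powr)
  have unit: "?D 1 x \<le> (2 * p - 1) * ?D x 1" for x
  proof (cases "x \<ge> 0")
    case True
    have D1x: "?D 1 x = 1 + (p - 1) * x powr p - p * x powr (p - 1)"
      using True by (cases "x = 0") (simp_all add: D powr_diff power2_eq_square)
    have "x powr (p - 1) \<ge> 1 + (p - 1) * (x - 1)"
      using powr_gt_tangent[of "p - 1" x] p True by (cases "x = 1") auto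
    then have "p * (x powr (p - 1) - 1 - (p - 1) * (x - 1)) \<ge> 0"
      using p by simp
    then have "?D 1 x \<le> (p - 1) * ?D x 1"
      using True unfolding D1x by (simp add: D algebra_simps)
    also have "\<dots> \<le> (2 * p - 1) * ?D x 1"
      using p bregman_abs_powr_pos[of p x 1] by (cases "x = 1") (auto simp: bregman_def intro!: mult_right_mono)
    finally show ?thesis .
  next
    case False
    define u where "u = - x"
    have u: "u > 0" "x = - u"
      using False by (auto simp: u_def)
    have D1x: "?D 1 x = 1 + (p - 1) * u powr p + p * u powr (p - 1)"
      using u by (simp add: D powr_diff power2_eq_square)
    have Dx1: "?D x 1 = u powr p + (p - 1) + p * u"
      using u by (simp add: D)
    have pw: "u powr p = u * u powr (p - 1)"
      using u by (simp add: powr_diff)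
    have "(2 * p - 1) * ?D x 1 - ?D 1 x
        = p * (u - 1) * u powr (p - 1) + (2 * p - 1) * p * u + p * (2 * p - 3)"
      unfolding D1x Dx1 pw by (simp add: algebra_simps)
    also have "\<dots> \<ge> 0"
    proof (cases "u \<ge> 1")
      case True
      then show ?thesis
        using p by (intro add_nonneg_nonneg mult_nonneg_nonneg) auto
    next
      case False
      then have "u powr (p - 1) \<le> 1"
        using u p by (intro powr_le1) auto
      then have "(1 - u) * u powr (p - 1) \<le> 1 * 1"
        using u False by (intro mult_mono) auto
      then have "p * ((1 - u) * u powr (p - 1)) \<le> p * (2 * p - 3)"
        using p by (intro mult_left_mono) auto
      moreover have "(2 * p - 1) * p * u \<ge> 0"
        using u p by simp
      ultimately show ?thesis
        by (simp add: algebra_simps)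
    qed
    finally show ?thesis by simp
  qed
  have "?D t s \<le> (2 * p - 1) * ?D s t" for s t
  \<comment> \<open>Homogeneity needs \<open>t \<noteq> 0\<close>; at \<open>t = 0\<close> the ratio is \<open>1 / (p - 1)\<close>.\<close>
  proof (cases "t = 0")
    case True
    then show ?thesis
      using p by (auto simp: D intro!: mult_right_mono)
  next
    case False
    define x where "x = s / t"
    have s: "s = x * t" using False by (simp add: x_def)
    have pw: "\<bar>t\<bar> powr (p - 2) * (t * t) = \<bar>t\<bar> powr p"
      using False by (simp add: powr_diff power2_eq_square)
    have "?D t s = \<bar>t\<bar> powr p * ?D 1 x" "?D s t = \<bar>t\<bar> powr p * ?D x 1"
      unfolding s using pw by (simp_all add: D abs_mult powr_mult algebra_simps)
    then show ?thesis
      using unit[of x] by (simp add: mult.left_commute mult_left_mono)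
  qed
  then have "\<forall>s t. 1 / (2 * p - 1) * ?D t s \<le> ?D s t"
    using p by (simp add: pos_divide_le_eq mult.commute)
  then show ?thesis
    using le_symmetry_coefficient_iff[of "\<lambda>t::real. \<bar>t\<bar> powr p"] bregman_abs_powr_pos p by simp
qed

text \<open>The ratio at the pair \<open>- u\<close>, \<open>1\<close>, where the lower bound is nearly attained for large \<open>p\<close>.\<close>
lemma symmetry_coefficient_abs_powr_le:
  assumes p: "p > 1" and u: "u > 0"
  shows "symmetry_coefficient (\<lambda>t::real. \<bar>t\<bar> powr p)
    \<le> (u powr p + (p - 1) + p * u) / (1 + (p - 1) * u powr p + p * u powr (p - 1))"
proof -
  let ?h = "\<lambda>t::real. \<bar>t\<bar> powr p"
  have "symmetry_coefficient ?h * bregman ?h 1 (- u) \<le> bregman ?h (- u) 1"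
    using le_symmetry_coefficient_iff[of ?h] bregman_abs_powr_pos p by blast
  moreover have "bregman ?h 1 (- u) = 1 + (p - 1) * u powr p + p * u powr (p - 1)"
    "bregman ?h (- u) 1 = u powr p + (p - 1) + p * u"
    using u p by (simp_all add: bregman_abs_powr powr_diff power2_eq_square)
  moreover have "bregman ?h 1 (- u) > 0"
    using u p by (intro bregman_abs_powr_pos) auto
  ultimately show ?thesis
    by (simp add: pos_le_divide_eq)
qed

lemma symmetry_coefficient_abs_powr_asymp:
  "(\<lambda>p. symmetry_coefficient (\<lambda>t::real. \<bar>t\<bar> powr p)) \<sim>[at_top] (\<lambda>p. 1 / (2 * p))"
proof (rule asymp_equivI')
  \<comment> \<open>With \<open>u = 1 + 1 / sqrt p\<close>, the power \<open>u powr p\<close> grows like \<open>exp (sqrt p - 1 / 2)\<close>,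
      which beats \<open>p\<close>, while \<open>u\<close> tends to \<open>1\<close>.\<close>
  define U where "U = (\<lambda>p::real. ((1 + 1 / sqrt p) powr p + (p - 1) + p * (1 + 1 / sqrt p))
      / (1 + (p - 1) * (1 + 1 / sqrt p) powr p + p * (1 + 1 / sqrt p) powr (p - 1)))"
  show "((\<lambda>p. symmetry_coefficient (\<lambda>t::real. \<bar>t\<bar> powr p) / (1 / (2 * p))) \<longlongrightarrow> 1) at_top"
  proof (rule tendsto_sandwich)
    show "\<forall>\<^sub>F p in at_top. 1 / (2 * p - 1) / (1 / (2 * p))
        \<le> symmetry_coefficient (\<lambda>t::real. \<bar>t\<bar> powr p) / (1 / (2 * p))"
      using eventually_gt_at_top[of 2]
      by eventually_elim (intro divide_right_mono symmetry_coefficient_abs_powr_ge, auto)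
    show "\<forall>\<^sub>F p in at_top. symmetry_coefficient (\<lambda>t::real. \<bar>t\<bar> powr p) / (1 / (2 * p))
        \<le> U p / (1 / (2 * p))"
      using eventually_gt_at_top[of 2] unfolding U_def
      by eventually_elim (intro divide_right_mono symmetry_coefficient_abs_powr_le, auto intro!: add_pos_pos)
    show "((\<lambda>p::real. 1 / (2 * p - 1) / (1 / (2 * p))) \<longlongrightarrow> 1) at_top"
      by real_asymp
    show "((\<lambda>p. U p / (1 / (2 * p))) \<longlongrightarrow> 1) at_top"
      unfolding U_def by real_asymp
  qed
qed

theorem corollary5p2:
  shows "(\<forall>p::real>2.
            symmetry_coefficient (\<lambda>x :: real ^ 'n. lr_norm 2 x powr p)
              = symmetry_coefficient (\<lambda>x :: real ^ 'n. lr_norm p x powr p)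
            \<and> symmetry_coefficient (\<lambda>x :: real ^ 'n. lr_norm p x powr p) > 1 / (2 * p))
         \<and> ((\<lambda>p. symmetry_coefficient (\<lambda>x :: real ^ 'n. lr_norm 2 x powr p))
              \<sim>[at_top] (\<lambda>p. 1 / (2 * p)))
         \<and> ((\<lambda>p. symmetry_coefficient (\<lambda>x :: real ^ 'n. lr_norm p x powr p))
              \<sim>[at_top] (\<lambda>p. 1 / (2 * p)))"
proof -
  let ?\<alpha> = "\<lambda>p. symmetry_coefficient (\<lambda>t::real. \<bar>t\<bar> powr p)"
  have two: "symmetry_coefficient (\<lambda>x :: real ^ 'n. lr_norm 2 x powr p) = ?\<alpha> p" if "p > 1" for p
    using symmetry_coefficient_norm_powr[OF that, where 'a = "real ^ 'n"] by (simp add: lr_norm_2)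
  have self: "symmetry_coefficient (\<lambda>x :: real ^ 'n. lr_norm p x powr p) = ?\<alpha> p" if "p > 1" for p
    using that by (rule symmetry_coefficient_lr_norm_powr)
  have "1 / (2 * p) < ?\<alpha> p" if "p > 2" for p
  proof -
    have "1 / (2 * p) < 1 / (2 * p - 1)"
      using that by (simp add: field_simps)
    also have "\<dots> \<le> ?\<alpha> p"
      using that by (rule symmetry_coefficient_abs_powr_ge)
    finally show ?thesis .
  qed
  moreover have "(\<lambda>p. symmetry_coefficient (\<lambda>x :: real ^ 'n. lr_norm 2 x powr p))
      \<sim>[at_top] (\<lambda>p. 1 / (2 * p))"
  proof (rule asymp_equiv_transfer[OF symmetry_coefficient_abs_powr_asymp])
    show "\<forall>\<^sub>F p in at_top. ?\<alpha> p = symmetry_coefficient (\<lambda>x :: real ^ 'n. lr_norm 2 x powr p)"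
      using eventually_gt_at_top[of 1] by eventually_elim (simp add: two)
  qed simp
  moreover have "(\<lambda>p. symmetry_coefficient (\<lambda>x :: real ^ 'n. lr_norm p x powr p))
      \<sim>[at_top] (\<lambda>p. 1 / (2 * p))"
  proof (rule asymp_equiv_transfer[OF symmetry_coefficient_abs_powr_asymp])
    show "\<forall>\<^sub>F p in at_top. ?\<alpha> p = symmetry_coefficient (\<lambda>x :: real ^ 'n. lr_norm p x powr p)"
      using eventually_gt_at_top[of 1] by eventually_elim (simp add: self)
  qed simp
  ultimately show ?thesis
    by (simp add: two self)
qed

end
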